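(* Let $L\subset\mathbb{R}^2$ be a square lattice whose unit square has side length $a>0$, let $P\in L$, and let $u\in\mathbb{R}^2$ be a unit vector whose direction makes an angle of $22.5^\circ$ with a side of a unit square of $L$. For $\gamma>0$ let $S_{\gamma}$ be the scaling along $u$ with factor $\gamma$ and drag center $P$. Then for every integer $k\ge 1$ the image $S_{\gamma}(L)$ with $\gamma=(3-2\sqrt{2})^k$ is again a square lattice. Moreover, for $k=1$, i.e. $\gamma=3-2\sqrt2$, the side length of the unit square of the resulting lattice is $(\sqrt{2}-1)\,a$.
   Context: A square lattice with side length $a$ is a set of the form $\{Q+m v+n w : m,n\in\mathbb{Z}\}\subset\mathbb{R}^2$, where $Q\in\mathbb{R}^2$ and $v,w$ are orthogonal vectors of length $a$; its unit squares are the squares of side $a$ with vertices in the lattice, with sides parallel to $v$ or $w$. An angle between a direction and a side means the (acute, unoriented) angle between the corresponding lines. The (directional) scaling along a unit vector $u$ with factor $\gamma>0$ and drag center $P$ is the affine map $S_\gamma(x)=x+(\gamma-1)\langle x-P,u\rangle u$, which multiplies the component of $x-P$ along $u$ by $\gamma$ and leaves the component orthogonal to $u$ unchanged. *)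

theory Defs
  imports "HOL-Analysis.Analysis"
begin

definition square_lattice_frame ::
    "real \<Rightarrow> (real^2) set \<Rightarrow> (real^2) \<Rightarrow> (real^2) \<Rightarrow> bool" where
  "square_lattice_frame a L v w \<longleftrightarrow>
     a > 0 \<and> norm v = a \<and> norm w = a \<and> orthogonal v w \<and>
     (\<exists>Q. L = {Q + real_of_int m *\<^sub>R v + real_of_int n *\<^sub>R w | m n. True})"

definition square_lattice :: "real \<Rightarrow> (real^2) set \<Rightarrow> bool" where
  "square_lattice a L \<longleftrightarrow> (\<exists>v w. square_lattice_frame a L v w)"

(* The vertices p, q, r, s are listed in cyclic order. *)
definition is_square :: "real \<Rightarrow> (real^2) \<Rightarrow> (real^2) \<Rightarrow> (real^2) \<Rightarrow> (real^2) \<Rightarrow> bool" where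
  "is_square a p q r s \<longleftrightarrow>
     norm (q - p) = a \<and> norm (s - p) = a \<and> orthogonal (q - p) (s - p) \<and> r - q = s - p"

(* A side is given by its pair of end points. *)
definition square_sides ::
    "(real^2) \<Rightarrow> (real^2) \<Rightarrow> (real^2) \<Rightarrow> (real^2) \<Rightarrow> ((real^2) \<times> (real^2)) set" where
  "square_sides p q r s = {(p, q), (q, r), (r, s), (s, p)}"

(* collinear {0, v, d} with v nonzero says that d is parallel to v. *)
definition unit_square ::
    "real \<Rightarrow> (real^2) set \<Rightarrow> (real^2) \<Rightarrow> (real^2) \<Rightarrow> (real^2) \<Rightarrow> (real^2) \<Rightarrow> bool" where
  "unit_square a L p q r s \<longleftrightarrow>
     is_square a p q r s \<and> {p, q, r, s} \<subseteq> L \<and>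
     (\<exists>v w. square_lattice_frame a L v w \<and>
        (\<forall>(x, y) \<in> square_sides p q r s.
           collinear {0, v, y - x} \<or> collinear {0, w, y - x}))"

(* Unoriented angle, in [0, pi/2], between the lines spanned by two nonzero vectors. *)
definition line_angle :: "(real^2) \<Rightarrow> (real^2) \<Rightarrow> real" where
  "line_angle x y = arccos (\<bar>x \<bullet> y\<bar> / (norm x * norm y))"

definition scaling :: "real \<Rightarrow> (real^2) \<Rightarrow> (real^2) \<Rightarrow> (real^2) \<Rightarrow> real^2" where
  "scaling \<gamma> u P x = x + ((\<gamma> - 1) * ((x - P) \<bullet> u)) *\<^sub>R u"

end

theory Submission
  imports Defs
begin

text \<open>Put \<open>P\<close> at the origin and choose an orthogonal frame \<open>v, w\<close> of the lattice with
  \<open>u = (cos (pi/8) v + sin (pi/8) w) / a\<close>. With \<open>\<gamma> = 3 - 2 sqrt 2\<close> and \<open>h = 1 - sqrt 2 / 2\<close>,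
  so that \<open>2 h^2 = \<gamma>\<close>, the scaling sends \<open>v\<close> to \<open>h (v - w)\<close> and \<open>w\<close> to \<open>h (3 w - v)\<close>.
  The image is thus also spanned by the orthogonal vectors \<open>h (v - w)\<close> and \<open>h (v + w)\<close> of length
  \<open>sqrt 2 h a = (sqrt 2 - 1) a\<close>. Applying the scaling twice gives
  \<open>\<gamma> (v - 2 w)\<close> and \<open>\<gamma> (5 w - 2 v)\<close>, a basis of the lattice shrunk by \<open>\<gamma>\<close>; hence the exponent
  can be lowered by two.\<close>

section \<open>Lattices with an explicit base point and generators\<close>

definition int_lattice :: "'a::real_vector \<Rightarrow> 'a \<Rightarrow> 'a \<Rightarrow> 'a set" where
  "int_lattice Q v w = {Q + real_of_int m *\<^sub>R v + real_of_int n *\<^sub>R w | m n. True}"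

lemma int_latticeI: "x = Q + real_of_int m *\<^sub>R v + real_of_int n *\<^sub>R w \<Longrightarrow> x \<in> int_lattice Q v w"
  unfolding int_lattice_def by blast

lemma int_lattice_subset:
  assumes "v' = real_of_int p *\<^sub>R v + real_of_int q *\<^sub>R w"
    and "w' = real_of_int r *\<^sub>R v + real_of_int s *\<^sub>R w"
  shows "int_lattice Q v' w' \<subseteq> int_lattice Q v w"
proof
  fix x assume "x \<in> int_lattice Q v' w'"
  then obtain m n where "x = Q + real_of_int m *\<^sub>R v' + real_of_int n *\<^sub>R w'"
    unfolding int_lattice_def by blast
  then have "x = Q + real_of_int (m * p + n * r) *\<^sub>R v + real_of_int (m * q + n * s) *\<^sub>R w"
    by (simp add: assms algebra_simps)
  then show "x \<in> int_lattice Q v w" by (rule int_latticeI)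
qed

text \<open>An integer matrix of determinant 1 or -1 has an integer inverse, so each pair of
  generators is an integer combination of the other.\<close>

lemma int_lattice_unimodular:
  assumes v': "v' = real_of_int p *\<^sub>R v + real_of_int q *\<^sub>R w"
    and w': "w' = real_of_int r *\<^sub>R v + real_of_int s *\<^sub>R w"
    and det: "p * s - q * r = 1 \<or> p * s - q * r = -1"
  shows "int_lattice Q v' w' = int_lattice Q v w"
proof (rule equalityI[OF int_lattice_subset[OF v' w']])
  \<comment> \<open>The determinant \<open>d\<close> is its own reciprocal, so the inverse matrix is
    \<open>d\<close> times the adjugate; its rows are the coefficients used below.\<close>
  define d where "d = p * s - q * r"
  have dd: "real_of_int d * (real_of_int p * real_of_int s - real_of_int q * real_of_int r) = 1"
    using det unfolding d_def by (auto simp flip: of_int_mult of_int_diff)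
  have "real_of_int (d * s) *\<^sub>R v' + real_of_int (- d * q) *\<^sub>R w'
      = (real_of_int d * (real_of_int p * real_of_int s - real_of_int q * real_of_int r)) *\<^sub>R v"
    by (simp add: v' w' algebra_simps)
  then have v: "v = real_of_int (d * s) *\<^sub>R v' + real_of_int (- d * q) *\<^sub>R w'"
    by (simp add: dd)
  have "real_of_int (- d * r) *\<^sub>R v' + real_of_int (d * p) *\<^sub>R w'
      = (real_of_int d * (real_of_int p * real_of_int s - real_of_int q * real_of_int r)) *\<^sub>R w"
    by (simp add: v' w' algebra_simps)
  then have w: "w = real_of_int (- d * r) *\<^sub>R v' + real_of_int (d * p) *\<^sub>R w'"
    by (simp add: dd)
  show "int_lattice Q v w \<subseteq> int_lattice Q v' w'"
    by (rule int_lattice_subset[OF v w])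
qed

lemma int_lattice_base_point:
  assumes "P \<in> int_lattice Q v w"
  shows "int_lattice Q v w = int_lattice P v w"
proof -
  from assms obtain m n where P: "P = Q + real_of_int m *\<^sub>R v + real_of_int n *\<^sub>R w"
    unfolding int_lattice_def by blast
  have "Q + real_of_int i *\<^sub>R v + real_of_int j *\<^sub>R w \<in> int_lattice P v w" for i j
    by (rule int_latticeI[of _ _ "i - m" _ "j - n"]) (simp add: P algebra_simps)
  moreover have "P + real_of_int i *\<^sub>R v + real_of_int j *\<^sub>R w \<in> int_lattice Q v w" for i j
    by (rule int_latticeI[of _ _ "i + m" _ "j + n"]) (simp add: P algebra_simps)
  ultimately show ?thesis
    unfolding int_lattice_def[of Q] int_lattice_def[of P] by (auto simp: int_lattice_def)
qed

section \<open>Scalings of lattices and orthogonal frames\<close>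

lemma square_lattice_int_lattice:
  assumes "a > 0" "norm v = a" "norm w = a" "orthogonal v w"
  shows "square_lattice a (int_lattice Q v w)"
  using assms unfolding square_lattice_def square_lattice_frame_def int_lattice_def by blast

text \<open>The scaling fixes its drag center \<open>P\<close> and has linear part
  \<open>scaling g u 0\<close>, so only the images of the generators matter.\<close>

lemma scaling_image_int_lattice:
  "scaling g u P ` int_lattice P v w = int_lattice P (scaling g u 0 v) (scaling g u 0 w)"
proof -
  have eq: "scaling g u P (P + real_of_int m *\<^sub>R v + real_of_int n *\<^sub>R w)
      = P + real_of_int m *\<^sub>R scaling g u 0 v + real_of_int n *\<^sub>R scaling g u 0 w" for m n
    by (simp add: scaling_def algebra_simps inner_add_left)
  show ?thesis
    unfolding int_lattice_def by (auto simp: eq image_iff) (metis eq)+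
qed

lemma scaling_scaling:
  assumes "norm u = 1"
  shows "scaling g u P (scaling h u P x) = scaling (g * h) u P x"
proof -
  have "u \<bullet> u = 1" using assms by (simp add: dot_square_norm)
  then show ?thesis
    by (simp add: scaling_def inner_add_left inner_diff_left algebra_simps flip: scaleR_add_left)
qed

lemma orthogonal_basis_expansion:
  fixes u v w :: "real^2"
  assumes "a > 0" "norm v = a" "norm w = a" "orthogonal v w"
  shows "u = ((u \<bullet> v) / a\<^sup>2) *\<^sub>R v + ((u \<bullet> w) / a\<^sup>2) *\<^sub>R w"
proof -
  define z where "z = u - (((u \<bullet> v) / a\<^sup>2) *\<^sub>R v + ((u \<bullet> w) / a\<^sup>2) *\<^sub>R w)"
  have vv: "v \<bullet> v = a\<^sup>2" "w \<bullet> w = a\<^sup>2" using assms by (auto simp: dot_square_norm)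
  have vw: "v \<bullet> w = 0" "w \<bullet> v = 0" using assms by (auto simp: orthogonal_def inner_commute)
  have zv: "z \<bullet> v = 0" "z \<bullet> w = 0"
    using \<open>a > 0\<close> by (auto simp: z_def inner_diff_left inner_add_left vv vw)
  \<comment> \<open>The residue \<open>z\<close> is orthogonal to both frame vectors. Their
    determinant \<open>d\<close> is nonzero by Lagrange's identity, and Cramer's rule then gives
    \<open>z = 0\<close>.\<close>
  define d where "d = v$1 * w$2 - v$2 * w$1"
  have "d\<^sup>2 + (v \<bullet> w)\<^sup>2 = (v \<bullet> v) * (w \<bullet> w)"
    by (simp add: d_def inner_vec_def sum_2 power2_eq_square algebra_simps)
  then have "d \<noteq> 0" using \<open>a > 0\<close> by (auto simp: vv vw)
  have "z$1 * d = (z \<bullet> v) * w$2 - (z \<bullet> w) * v$2" "z$2 * d = (z \<bullet> w) * v$1 - (z \<bullet> v) * w$1"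
    by (simp_all add: d_def inner_vec_def sum_2 algebra_simps)
  then have "z$1 = 0" "z$2 = 0" using \<open>d \<noteq> 0\<close> by (auto simp: zv)
  then have "z = 0" by (simp add: vec_eq_iff forall_2)
  then show ?thesis by (simp add: z_def)
qed

section \<open>The scaling in a frame at angle \<open>pi/8\<close>: once, twice, repeatedly\<close>

lemma cos_pi8_sq: "cos (pi/8) ^ 2 = (2 + sqrt 2) / 4"
  and sin_pi8_sq: "sin (pi/8) ^ 2 = (2 - sqrt 2) / 4"
  and cos_sin_pi8: "cos (pi/8) * sin (pi/8) = sqrt 2 / 4"
proof -
  \<comment> \<open>The double-angle formulas yield the squares and the product; working only with
    these avoids nested radicals.\<close>
  have "cos (pi/4) = 2 * cos (pi/8) ^ 2 - 1" using cos_double_cos[of "pi/8"] by simp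
  then show c: "cos (pi/8) ^ 2 = (2 + sqrt 2) / 4" by (simp add: cos_45 field_simps)
  have "sin (pi/8) ^ 2 = 1 - cos (pi/8) ^ 2" by (simp add: sin_squared_eq)
  then show "sin (pi/8) ^ 2 = (2 - sqrt 2) / 4" unfolding c by (simp add: field_simps)
  have "sin (pi/4) = 2 * sin (pi/8) * cos (pi/8)" using sin_double[of "pi/8"] by simp
  then show "cos (pi/8) * sin (pi/8) = sqrt 2 / 4" by (simp add: sin_45 field_simps)
qed

text \<open>A normal form of the angle hypothesis: \<open>u\<close> lies between \<open>v\<close>
  and \<open>w\<close>, nearer to \<open>v\<close>. The orientation of the frame is left
  free.\<close>

definition frame_pi8 :: "real \<Rightarrow> real^2 \<Rightarrow> real^2 \<Rightarrow> real^2 \<Rightarrow> bool" where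
  "frame_pi8 a u v w \<longleftrightarrow> a > 0 \<and> norm v = a \<and> norm w = a \<and> orthogonal v w
     \<and> u = (cos (pi/8) / a) *\<^sub>R v + (sin (pi/8) / a) *\<^sub>R w"

lemma frame_pi8_scale:
  assumes "frame_pi8 a u v w" "c > 0"
  shows "frame_pi8 (c * a) u (c *\<^sub>R v) (c *\<^sub>R w)"
  using assms by (auto simp: frame_pi8_def orthogonal_def)

lemma scaling_frame_pi8:
  assumes "frame_pi8 a u v w"
  shows "scaling (3 - 2 * sqrt 2) u 0 v = (1 - sqrt 2 / 2) *\<^sub>R (v - w)" (is ?v)
    and "scaling (3 - 2 * sqrt 2) u 0 w = (1 - sqrt 2 / 2) *\<^sub>R (3 *\<^sub>R w - v)" (is ?w)
proof -
  define c s where "c = cos (pi/8)" and "s = sin (pi/8)"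
  have a: "a > 0" and u: "u = (c / a) *\<^sub>R v + (s / a) *\<^sub>R w"
    and vv: "v \<bullet> v = a\<^sup>2" "w \<bullet> w = a\<^sup>2" "v \<bullet> w = 0" "w \<bullet> v = 0"
    using assms by (auto simp: frame_pi8_def c_def s_def dot_square_norm orthogonal_def inner_commute)
  have vu: "v \<bullet> u = a * c" "w \<bullet> u = a * s"
    using a by (simp_all add: u inner_add_right vv power2_eq_square)
  have au: "a *\<^sub>R u = c *\<^sub>R v + s *\<^sub>R w" using a by (simp add: u scaleR_add_right)
  have 1: "c * c = (2 + sqrt 2) / 4" "s * s = (2 - sqrt 2) / 4" "c * s = sqrt 2 / 4"
    using cos_pi8_sq sin_pi8_sq cos_sin_pi8 by (simp_all add: c_def s_def power2_eq_square)
  \<comment> \<open>With \<open>2 - 2 * sqrt 2\<close> being the factor minus 1, these are the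
    entries of the scaling matrix minus the identity. Adding the identity gives
    \<open>1 - sqrt 2 / 2\<close> times the integer matrix with rows (1, -1) and (-1, 3).\<close>
  have e: "(2 - 2 * sqrt 2) * (c * c) = - (sqrt 2 / 2)"
    "(2 - 2 * sqrt 2) * (c * s) = sqrt 2 / 2 - 1"
    "(2 - 2 * sqrt 2) * (s * s) = 2 - 3 * sqrt 2 / 2"
    unfolding 1 by (simp_all add: field_simps)
  have "scaling (3 - 2 * sqrt 2) u 0 v = v + ((2 - 2 * sqrt 2) * c) *\<^sub>R (a *\<^sub>R u)"
    by (simp add: scaling_def vu mult.commute mult.left_commute)
  also have "\<dots> = v + ((2 - 2 * sqrt 2) * (c * c)) *\<^sub>R v + ((2 - 2 * sqrt 2) * (c * s)) *\<^sub>R w"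
    unfolding au by (simp add: scaleR_add_right mult.assoc add.assoc)
  also have "\<dots> = (1 - sqrt 2 / 2) *\<^sub>R (v - w)"
    unfolding e by (simp add: algebra_simps)
  finally show ?v .
  have "scaling (3 - 2 * sqrt 2) u 0 w = w + ((2 - 2 * sqrt 2) * s) *\<^sub>R (a *\<^sub>R u)"
    by (simp add: scaling_def vu mult.commute mult.left_commute)
  also have "\<dots> = w + ((2 - 2 * sqrt 2) * (c * s)) *\<^sub>R v + ((2 - 2 * sqrt 2) * (s * s)) *\<^sub>R w"
    unfolding au by (simp add: scaleR_add_right mult.assoc mult.commute add.assoc mult.left_commute)
  also have "\<dots> = (1 - sqrt 2 / 2) *\<^sub>R (3 *\<^sub>R w - v)"
    unfolding e by (simp add: vec_eq_iff algebra_simps)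
  finally show ?w .
qed

lemma square_lattice_scaling_once:
  assumes "frame_pi8 a u v w"
  shows "square_lattice ((sqrt 2 - 1) * a) (scaling (3 - 2 * sqrt 2) u P ` int_lattice P v w)"
proof -
  define h where "h = 1 - sqrt 2 / 2"
  have h: "h > 0" using sqrt2_less_2 by (simp add: h_def)
  have a: "a > 0" and vv: "v \<bullet> v = a\<^sup>2" "w \<bullet> w = a\<^sup>2" "v \<bullet> w = 0" "w \<bullet> v = 0"
    using assms by (auto simp: frame_pi8_def dot_square_norm orthogonal_def inner_commute)
  have n: "norm (v - w) = sqrt 2 * a" "norm (v + w) = sqrt 2 * a"
    using a by (simp_all add: norm_eq_sqrt_inner inner_diff_left inner_diff_right inner_add_left
        inner_add_right vv real_sqrt_mult)
  have hs: "h * (sqrt 2 * a) = (sqrt 2 - 1) * a" by (simp add: h_def algebra_simps)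
  have "square_lattice ((sqrt 2 - 1) * a) (int_lattice P (h *\<^sub>R (v - w)) (h *\<^sub>R (v + w)))"
  proof (rule square_lattice_int_lattice)
    show "(sqrt 2 - 1) * a > 0" using a by simp
    show "norm (h *\<^sub>R (v - w)) = (sqrt 2 - 1) * a" "norm (h *\<^sub>R (v + w)) = (sqrt 2 - 1) * a"
      using h hs by (simp_all add: n)
    show "orthogonal (h *\<^sub>R (v - w)) (h *\<^sub>R (v + w))"
      by (simp add: orthogonal_def inner_diff_left inner_add_right vv)
  qed
  \<comment> \<open>Here \<open>v + w\<close> is twice \<open>v - w\<close> plus
    \<open>3 w - v\<close>, a shear of determinant 1.\<close>
  also have "int_lattice P (h *\<^sub>R (v - w)) (h *\<^sub>R (v + w))
      = int_lattice P (h *\<^sub>R (v - w)) (h *\<^sub>R (3 *\<^sub>R w - v))"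
    by (rule int_lattice_unimodular[where p = 1 and q = 0 and r = 2 and s = 1])
      (simp_all add: vec_eq_iff algebra_simps)
  also have "\<dots> = scaling (3 - 2 * sqrt 2) u P ` int_lattice P v w"
    by (simp add: scaling_image_int_lattice scaling_frame_pi8[OF assms] h_def)
  finally show ?thesis .
qed

text \<open>The integer matrix with rows (1, -1) and (-1, 3) squares to twice the matrix with rows
  (1, -2) and (-2, 5), which has determinant 1; the factor 2 combines with the square of
  \<open>h\<close> to give \<open>g\<close>.\<close>

lemma scaling_twice_int_lattice:
  assumes "frame_pi8 a u v w" "norm u = 1"
  shows "scaling ((3 - 2 * sqrt 2) ^ 2) u P ` int_lattice P v w
    = int_lattice P ((3 - 2 * sqrt 2) *\<^sub>R v) ((3 - 2 * sqrt 2) *\<^sub>R w)"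
proof -
  define g h where "g = 3 - 2 * sqrt 2" and "h = 1 - sqrt 2 / 2"
  have hh: "g = 2 * (h * h)" by (simp add: g_def h_def algebra_simps)
  note sc = scaling_frame_pi8[OF assms(1), folded g_def h_def]
  \<comment> \<open>This shape covers both images: \<open>x = y = -1\<close> gives
    \<open>v - w\<close>, and \<open>x = 3\<close>, \<open>y = 1\<close> gives
    \<open>3 w - v\<close>.\<close>
  have lin: "scaling g u 0 (h *\<^sub>R (x *\<^sub>R w - y *\<^sub>R v))
      = h *\<^sub>R (x *\<^sub>R scaling g u 0 w - y *\<^sub>R scaling g u 0 v)" for x y
    by (simp add: scaling_def inner_diff_left algebra_simps)
  have "scaling (g ^ 2) u 0 v = h *\<^sub>R (h *\<^sub>R (v - w) - h *\<^sub>R (3 *\<^sub>R w - v))"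
    using lin[of "-1" "-1"] by (simp add: power2_eq_square sc flip: scaling_scaling[OF assms(2)])
  then have v: "scaling (g ^ 2) u 0 v = real_of_int 1 *\<^sub>R (g *\<^sub>R v) + real_of_int (-2) *\<^sub>R (g *\<^sub>R w)"
    by (simp add: hh vec_eq_iff algebra_simps)
  have "scaling (g ^ 2) u 0 w = h *\<^sub>R (3 *\<^sub>R (h *\<^sub>R (3 *\<^sub>R w - v)) - h *\<^sub>R (v - w))"
    using lin[of 3 1] by (simp add: power2_eq_square sc flip: scaling_scaling[OF assms(2)])
  then have w: "scaling (g ^ 2) u 0 w = real_of_int (-2) *\<^sub>R (g *\<^sub>R v) + real_of_int 5 *\<^sub>R (g *\<^sub>R w)"
    by (simp add: hh vec_eq_iff algebra_simps)
  show ?thesis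
    unfolding g_def[symmetric] scaling_image_int_lattice
    by (rule int_lattice_unimodular[OF v w]) simp
qed

text \<open>Two scalings merely shrink the lattice, and the shrunk frame has the same position
  relative to \<open>u\<close>. Hence the induction goes in steps of two, with the frame and its
  side length generalized.\<close>

lemma square_lattice_scaling_power:
  assumes "frame_pi8 a u v w" "norm u = 1"
  shows "\<exists>b. square_lattice b (scaling ((3 - 2 * sqrt 2) ^ k) u P ` int_lattice P v w)"
  using assms(1)
proof (induction k arbitrary: a v w rule: induct_nat_012)
  case 0
  have "scaling 1 u P ` int_lattice P v w = int_lattice P v w" by (simp add: scaling_def)
  with 0 show ?case
    by (auto simp: frame_pi8_def intro: square_lattice_int_lattice)
next
  case 1
  then show ?case using square_lattice_scaling_once[OF 1, of P] by auto
next
  case (ge2 k)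
  define g :: real where "g = 3 - 2 * sqrt 2"
  \<comment> \<open>Positivity of \<open>g\<close> keeps the side length of the shrunk frame
    positive.\<close>
  have "sqrt 2 < sqrt ((3/2)\<^sup>2)" by (rule real_sqrt_less_mono) (simp add: power2_eq_square)
  then have "g > 0" by (simp add: g_def)
  have "scaling (g ^ Suc (Suc k)) u P = scaling (g ^ k) u P \<circ> scaling (g ^ 2) u P"
    by (auto simp: scaling_scaling[OF assms(2)] power2_eq_square mult_ac)
  then have "scaling (g ^ Suc (Suc k)) u P ` int_lattice P v w
      = scaling (g ^ k) u P ` int_lattice P (g *\<^sub>R v) (g *\<^sub>R w)"
    using scaling_twice_int_lattice[OF ge2.prems assms(2), of P] by (simp add: image_comp g_def flip: image_image)
  then show ?case
    using ge2.IH(1)[OF frame_pi8_scale[OF ge2.prems \<open>g > 0\<close>]] by (simp add: g_def)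
qed

section \<open>Obtaining the frame from the angle hypothesis\<close>

lemma unit_square_side_parallel:
  assumes "unit_square a L p q r s" "(x, y) \<in> square_sides p q r s"
  obtains v w where "square_lattice_frame a L v w" "norm (y - x) = a" "collinear {0, v, y - x}"
proof -
  from assms(1) obtain v w where f: "square_lattice_frame a L v w"
    and par: "collinear {0, v, y - x} \<or> collinear {0, w, y - x}"
    using assms(2) unfolding unit_square_def by blast
  have sq: "norm (q - p) = a" "norm (s - p) = a" "r - q = s - p"
    using assms(1) by (auto simp: unit_square_def is_square_def)
  from sq(3) have "s - r = p - q" by (simp add: algebra_simps)
  with sq have "norm (r - q) = a" "norm (s - r) = a" "norm (p - s) = a"
    by (simp_all add: norm_minus_commute)
  with sq(1) have n: "norm (y - x) = a"
    using assms(2) by (auto simp: square_sides_def)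
  \<comment> \<open>Swapping the generators has determinant -1, so the given side may be assumed
    parallel to the first one.\<close>
  have "square_lattice_frame a L w v"
  proof -
    from f obtain Q where *: "L = int_lattice Q v w"
      by (auto simp: square_lattice_frame_def int_lattice_def)
    have "L = int_lattice Q w v"
      unfolding * by (rule int_lattice_unimodular[where p = 0 and q = 1 and r = 1 and s = 0]) auto
    with f show ?thesis
      unfolding square_lattice_frame_def int_lattice_def by (auto simp: orthogonal_commute)
  qed
  with f par n that show thesis by blast
qed

text \<open>The angle determines the inner product of \<open>u\<close> with \<open>v\<close> up to
  sign, and Pythagoras then the one with \<open>w\<close>; reversing frame vectors makes both
  positive.\<close>

lemma frame_pi8_exists:
  assumes "a > 0" "P \<in> L" "norm u = 1"
    and sq: "unit_square a L p q r s" "(x, y) \<in> square_sides p q r s"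
    and ang: "line_angle u (y - x) = pi / 8"
  obtains v w where "frame_pi8 a u v w" "L = int_lattice P v w"
proof -
  from unit_square_side_parallel[OF sq] obtain v w where
    f: "square_lattice_frame a L v w" and n: "norm (y - x) = a" and par: "collinear {0, v, y - x}" .
  have nv: "norm v = a" "norm w = a" and orth: "orthogonal v w"
    using f by (auto simp: square_lattice_frame_def)
  from f obtain Q where "L = int_lattice Q v w"
    by (auto simp: square_lattice_frame_def int_lattice_def)
  with \<open>P \<in> L\<close> have L: "L = int_lattice P v w" using int_lattice_base_point by metis
  from par obtain c where c: "y - x = c *\<^sub>R v"
    using nv \<open>a > 0\<close> by (auto simp: collinear_lemma)
  with n nv \<open>a > 0\<close> have "\<bar>c\<bar> = 1" by simp
  then have "\<bar>u \<bullet> (y - x)\<bar> = \<bar>u \<bullet> v\<bar>" by (simp add: c abs_mult)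
  with ang n assms(3) have ac: "arccos (\<bar>u \<bullet> v\<bar> / a) = pi / 8" by (simp add: line_angle_def)
  \<comment> \<open>Cauchy-Schwarz keeps the argument of \<open>arccos\<close> within the range
    where \<open>cos\<close> inverts it.\<close>
  have "\<bar>u \<bullet> v\<bar> \<le> a" using Cauchy_Schwarz_ineq2[of u v] nv assms(3) by simp
  then have "\<bar>u \<bullet> v\<bar> / a = cos (pi / 8)"
    using cos_arccos[of "\<bar>u \<bullet> v\<bar> / a"] \<open>a > 0\<close> ac by (simp add: divide_le_eq le_divide_eq)
  then have uv: "\<bar>u \<bullet> v\<bar> = a * cos (pi / 8)" using \<open>a > 0\<close> by (simp add: field_simps)
  have ex: "u = ((u \<bullet> v) / a\<^sup>2) *\<^sub>R v + ((u \<bullet> w) / a\<^sup>2) *\<^sub>R w"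
    by (rule orthogonal_basis_expansion[OF \<open>a > 0\<close> nv orth])
  have "1 = u \<bullet> u" using assms(3) by (simp add: dot_square_norm)
  \<comment> \<open>The expansion is substituted into the second factor of
    \<open>u \<bullet> u\<close> only.\<close>
  also have "\<dots> = (u \<bullet> v)\<^sup>2 / a\<^sup>2 + (u \<bullet> w)\<^sup>2 / a\<^sup>2"
    by (subst (2) ex) (simp add: inner_add_right power2_eq_square)
  finally have "(u \<bullet> v)\<^sup>2 + (u \<bullet> w)\<^sup>2 = a\<^sup>2" using \<open>a > 0\<close> by (simp add: field_simps)
  moreover have "(u \<bullet> v)\<^sup>2 = a\<^sup>2 * (cos (pi / 8))\<^sup>2"
    using uv by (metis power2_abs power_mult_distrib)
  ultimately have "(u \<bullet> w)\<^sup>2 = (a * sin (pi / 8))\<^sup>2"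
    by (simp add: sin_squared_eq power_mult_distrib algebra_simps)
  moreover have "sin (pi / 8) > 0" by (rule sin_gt_zero) auto
  ultimately have uw: "\<bar>u \<bullet> w\<bar> = a * sin (pi / 8)"
    using \<open>a > 0\<close> by (metis abs_of_pos mult_pos_pos power2_eq_iff abs_minus_cancel)
  \<comment> \<open>The signs \<open>i\<close> and \<open>j\<close> form a diagonal matrix of
    determinant 1 or -1, so the lattice is unchanged.\<close>
  define i j :: int where "i = (if u \<bullet> v < 0 then -1 else 1)" and "j = (if u \<bullet> w < 0 then -1 else 1)"
  define v' w' where "v' = real_of_int i *\<^sub>R v" and "w' = real_of_int j *\<^sub>R w"
  have n': "norm v' = a" "norm w' = a" "orthogonal v' w'"
    using nv orth by (auto simp: v'_def w'_def i_def j_def orthogonal_def)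
  have "u \<bullet> v' = a * cos (pi / 8)" "u \<bullet> w' = a * sin (pi / 8)"
    using uv uw by (auto simp: v'_def w'_def i_def j_def)
  with orthogonal_basis_expansion[OF \<open>a > 0\<close> n', of u] n' \<open>a > 0\<close> have "frame_pi8 a u v' w'"
    by (simp add: frame_pi8_def power2_eq_square)
  moreover have "L = int_lattice P v' w'"
    unfolding L
    by (rule int_lattice_unimodular[where p = i and q = 0 and r = 0 and s = j, symmetric])
      (auto simp: v'_def w'_def i_def j_def)
  ultimately show thesis by (rule that)
qed

theorem mainTheorem2:
  fixes L :: "(real^2) set" and P u :: "real^2" and a :: real
  assumes "a > 0"
    and "square_lattice a L"
    and "P \<in> L"
    and "norm u = 1"
    and "\<exists>p q r s x y. unit_square a L p q r s \<and> (x, y) \<in> square_sides p q r s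
           \<and> line_angle u (y - x) = pi / 8"
  shows "(\<forall>k::nat. k \<ge> 1 \<longrightarrow>
            (\<exists>b. square_lattice b (scaling ((3 - 2 * sqrt 2) ^ k) u P ` L)))
       \<and> square_lattice ((sqrt 2 - 1) * a) (scaling (3 - 2 * sqrt 2) u P ` L)"
proof -
  from assms(5) obtain p q r s x y where "unit_square a L p q r s" "(x, y) \<in> square_sides p q r s"
    "line_angle u (y - x) = pi / 8" by blast
  with frame_pi8_exists[OF assms(1,3,4)] obtain v w where "frame_pi8 a u v w" "L = int_lattice P v w"
    by metis
  then show ?thesis
    using square_lattice_scaling_power[OF _ assms(4)] square_lattice_scaling_once by blast
qed

end
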